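(* Let $G_1$ and $G_2$ be graphs, let $m_1$ be the number of edges of $G_1$, and suppose that $G_1\diamond G_2$ admits a weak integer additive set-indexer $f$. Then, with respect to $f$, either $G_1$ is $1$-uniform or $m_1-m_1'$ of the $m_1$ copies of $G_2$ in $G_1\diamond G_2$ are $1$-uniform, where $m_1'$ is the number of mono-indexed edges of $G_1$ (viewed as a subgraph of $G_1\diamond G_2$).
   Context: All graphs are simple, finite and have no isolated vertices. $\mathbb{N}_0$ is the set of non-negative integers, $\mathcal{P}(\mathbb{N}_0)$ is its power set, and the sum set of $A,B\subseteq\mathbb{N}_0$ is $A+B=\{a+b: a\in A,\ b\in B\}$. All sets used as labels are finite. An integer additive set-indexer (IASI) of a graph $G$ is an injective function $f:V(G)\to\mathcal{P}(\mathbb{N}_0)$ such that the induced function $f^+:E(G)\to\mathcal{P}(\mathbb{N}_0)$, $f^+(uv)=f(u)+f(v)$, is also injective. It is a weak IASI if $|f^+(uv)|=\max(|f(u)|,|f(v)|)$ for every edge $uv\in E(G)$. The set-label of a vertex $v$ is $f(v)$ and that of an edge $e$ is $f^+(e)$. A vertex or edge is mono-indexed if its set-label has cardinality $1$. A graph (or a subgraph) is $1$-uniform if the set-labels of all its vertices and edges are singleton sets. Edge corona: if $G_1$ has $m_1$ edges, $G_1\diamond G_2$ is the graph obtained from $G_1$ by taking $m_1$ disjoint copies of $G_2$ (one for each edge of $G_1$) and joining both end vertices of the $i$-th edge of $G_1$ to every vertex of the $i$-th copy of $G_2$. *)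

theory Defs
  imports Main "HOL-Library.Set_Algebras"
begin

record 'a ugraph =
  verts :: "'a set"
  edges :: "'a set set"

text \<open>Finite simple graphs without isolated vertices; an edge is a two-element set of vertices.\<close>

definition simple_graph :: "'a ugraph \<Rightarrow> bool" where
  "simple_graph G \<longleftrightarrow>
     finite (verts G) \<and>
     (\<forall>e\<in>edges G. e \<subseteq> verts G \<and> card e = 2) \<and>
     (\<forall>v\<in>verts G. \<exists>e\<in>edges G. v \<in> e)"

definition image_graph :: "('a \<Rightarrow> 'b) \<Rightarrow> 'a ugraph \<Rightarrow> 'b ugraph" where
  "image_graph h G = \<lparr>verts = h ` verts G, edges = (`) h ` edges G\<rparr>"

text \<open>In the edge corona of \<open>G1\<close> and \<open>G2\<close>, the vertex \<open>u\<close> of \<open>G1\<close> becomes \<open>Inl u\<close>, and the vertex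
  \<open>x\<close> of the copy of \<open>G2\<close> belonging to the edge \<open>e\<close> of \<open>G1\<close> is \<open>Inr (e, x)\<close>.\<close>

definition base_of :: "'a ugraph \<Rightarrow> ('a + 'a set \<times> 'b) ugraph" where
  "base_of G1 = image_graph Inl G1"

definition copy_of :: "'b ugraph \<Rightarrow> 'a set \<Rightarrow> ('a + 'a set \<times> 'b) ugraph" where
  "copy_of G2 e = image_graph (\<lambda>x. Inr (e, x)) G2"

definition edge_corona :: "'a ugraph \<Rightarrow> 'b ugraph \<Rightarrow> ('a + 'a set \<times> 'b) ugraph"
    (infixl "\<diamondop>" 65) where
  "G1 \<diamondop> G2 =
     \<lparr>verts = verts (base_of G1) \<union> (\<Union>e\<in>edges G1. verts (copy_of G2 e)),
      edges = edges (base_of G1) \<union> (\<Union>e\<in>edges G1. edges (copy_of G2 e)) \<union>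
        {{Inl u, Inr (e, x)} | u e x. e \<in> edges G1 \<and> u \<in> e \<and> x \<in> verts G2}\<rparr>"

text \<open>The sum is taken in the additive monoid of sets of naturals (with \<open>A + B\<close> the sum set and zero
  \<open>{0}\<close>), so on an edge \<open>{u, v}\<close> with \<open>u \<noteq> v\<close> this is the sum set \<open>f u + f v\<close>.\<close>

definition edge_label :: "('a \<Rightarrow> nat set) \<Rightarrow> 'a set \<Rightarrow> nat set" where
  "edge_label f e = (\<Sum>v\<in>e. f v)"

lemma edge_label_pair: "u \<noteq> v \<Longrightarrow> edge_label f {u, v} = {a + b | a b. a \<in> f u \<and> b \<in> f v}"
  by (auto simp: edge_label_def set_plus_def)

definition iasi :: "'a ugraph \<Rightarrow> ('a \<Rightarrow> nat set) \<Rightarrow> bool" where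
  "iasi G f \<longleftrightarrow>
     (\<forall>v\<in>verts G. finite (f v)) \<and> inj_on f (verts G) \<and> inj_on (edge_label f) (edges G)"

definition weak_iasi :: "'a ugraph \<Rightarrow> ('a \<Rightarrow> nat set) \<Rightarrow> bool" where
  "weak_iasi G f \<longleftrightarrow> iasi G f \<and>
     (\<forall>u v. {u, v} \<in> edges G \<longrightarrow> card (edge_label f {u, v}) = max (card (f u)) (card (f v)))"

definition mono_indexed_edges :: "'a ugraph \<Rightarrow> ('a \<Rightarrow> nat set) \<Rightarrow> 'a set set" where
  "mono_indexed_edges G f = {e \<in> edges G. card (edge_label f e) = 1}"

definition one_uniform :: "'a ugraph \<Rightarrow> ('a \<Rightarrow> nat set) \<Rightarrow> bool" where
  "one_uniform G f \<longleftrightarrow>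
     (\<forall>v\<in>verts G. card (f v) = 1) \<and> (\<forall>e\<in>edges G. card (edge_label f e) = 1)"

lemma simple_graph_edge_corona:
  assumes "simple_graph G1" "simple_graph G2"
  shows "simple_graph (G1 \<diamondop> G2)"
proof -
  have fin: "finite (edges G1)"
    by (rule finite_subset[of _ "Pow (verts G1)"]) (use assms in \<open>auto simp: simple_graph_def\<close>)
  have c: "card (h ` e) = card e" if "inj h" for h :: "'c \<Rightarrow> 'd" and e
    using that by (metis card_image inj_on_subset subset_UNIV)
  have i: "inj (\<lambda>x. Inr (e, x) :: 'a + 'a set \<times> 'b)" for e
    by (auto simp: inj_on_def)
  have "finite (verts (G1 \<diamondop> G2))"
    using assms fin
    by (auto simp: edge_corona_def base_of_def copy_of_def image_graph_def simple_graph_def)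
  moreover have "d \<subseteq> verts (G1 \<diamondop> G2) \<and> card d = 2" if d: "d \<in> edges (G1 \<diamondop> G2)" for d
  proof -
    consider (base) e where "e \<in> edges G1" "d = Inl ` e"
      | (copy) e k where "e \<in> edges G1" "k \<in> edges G2" "d = (\<lambda>x. Inr (e, x)) ` k"
      | (join) u e x where "e \<in> edges G1" "u \<in> e" "x \<in> verts G2" "d = {Inl u, Inr (e, x)}"
      using d by (auto simp: edge_corona_def base_of_def copy_of_def image_graph_def)
    then show ?thesis
    proof cases
      case base
      then have "e \<subseteq> verts G1" "card e = 2" using assms(1) by (auto simp: simple_graph_def)
      then show ?thesis using base
        by (auto simp: edge_corona_def base_of_def image_graph_def c)
    next
      case copy
      then have "k \<subseteq> verts G2" "card k = 2" using assms(2) by (auto simp: simple_graph_def)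
      then show ?thesis using copy
        by (auto simp: edge_corona_def copy_of_def image_graph_def c i)
    next
      case join
      then have "e \<subseteq> verts G1" using assms(1) by (auto simp: simple_graph_def)
      then show ?thesis using join
        by (auto simp: edge_corona_def base_of_def copy_of_def image_graph_def)
    qed
  qed
  moreover have "\<exists>d\<in>edges (G1 \<diamondop> G2). v \<in> d" if v: "v \<in> verts (G1 \<diamondop> G2)" for v
  proof -
    consider (base) u where "u \<in> verts G1" "v = Inl u"
      | (copy) e x where "e \<in> edges G1" "x \<in> verts G2" "v = Inr (e, x)"
      using v by (auto simp: edge_corona_def base_of_def copy_of_def image_graph_def)
    then show ?thesis
    proof cases
      case base
      then obtain e where "e \<in> edges G1" "u \<in> e" using assms(1) by (auto simp: simple_graph_def)
      then have "Inl ` e \<in> edges (G1 \<diamondop> G2)" "v \<in> Inl ` e"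
        using base by (auto simp: edge_corona_def base_of_def image_graph_def)
      then show ?thesis by blast
    next
      case copy
      then obtain k where k: "k \<in> edges G2" "x \<in> k" using assms(2) by (auto simp: simple_graph_def)
      have "(\<lambda>y. Inr (e, y)) ` k \<in> edges (G1 \<diamondop> G2)"
        using copy k by (auto simp: edge_corona_def copy_of_def image_graph_def)
      moreover have "v \<in> (\<lambda>y. Inr (e, y)) ` k" using copy(3) k(2) by simp
      ultimately show ?thesis by (rule bexI[rotated])
    qed
  qed
  ultimately show ?thesis by (auto simp: simple_graph_def)
qed

end

theory Submission imports Defs begin

text \<open>
  The sum of two finite non-empty sets of numbers has strictly more elements than either summand as
  soon as the other summand has at least two elements. Hence a weak IASI gives a singleton label to at
  least one end of every edge, so a vertex whose label is not a singleton forces singleton labels on all its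
  neighbours. If an edge of \<open>G1\<close> is not mono-indexed, then one of its ends is such a vertex; in the
  corona this end is joined to the whole copy of \<open>G2\<close> belonging to the edge, and that copy is
  therefore \<open>1\<close>-uniform. The edges of \<open>G1\<close> that are not mono-indexed number \<open>m1 - m1'\<close>, and
  they index the \<open>1\<close>-uniform copies sought.
\<close>

text \<open>All \<open>a + Min B\<close> with \<open>a \<in> A\<close> are distinct elements of the sum set, and \<open>Max A + Max B\<close>
  exceeds each of them.\<close>

lemma card_less_card_sumset:
  fixes A B :: "'a :: linordered_cancel_ab_semigroup_add set"
  assumes "finite A" "finite B" "A \<noteq> {}" "1 < card B"
  shows "card A < card (A + B)"
proof -
  have ne: "B \<noteq> {}" and "\<not> is_singleton B"
    using assms(4) by (auto simp: is_singleton_altdef)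
  then have "Min B \<noteq> Max B"
    using assms(2) by (metis Max_ge Min_le antisym is_singletonI' order_trans)
  then have lt: "Min B < Max B"
    using assms(2) ne by (meson Max_ge Min_in order_le_neq_trans)
  have "(\<lambda>a. a + Min B) ` A \<subseteq> A + B"
    using Min_in[OF assms(2) ne] by (auto intro: set_plus_intro)
  moreover have "Max A + Max B \<in> A + B"
    using assms(1-3) ne by (intro set_plus_intro Max_in)
  moreover have "a + Min B < Max A + Max B" if "a \<in> A" for a
    using assms(1) that lt by (auto intro: add_le_less_mono)
  then have "Max A + Max B \<notin> (\<lambda>a. a + Min B) ` A"
    by force
  ultimately have "(\<lambda>a. a + Min B) ` A \<subset> A + B"
    by blast
  then have "card ((\<lambda>a. a + Min B) ` A) < card (A + B)"
    using assms(1,2) by (intro psubset_card_mono finite_set_plus)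
  then show ?thesis
    by (simp add: card_image inj_on_def)
qed

text \<open>If one of the two labels were empty, so would be the sum set, and then the equation
  \<open>\<bar>f u + f v\<bar> = max \<bar>f u\<bar> \<bar>f v\<bar>\<close> would make both labels empty, contrary to injectivity.\<close>

lemma weak_iasi_singleton_end:
  assumes "simple_graph G" "weak_iasi G f" "{u, v} \<in> edges G"
  shows "card (f u) = 1 \<or> card (f v) = 1"
proof (rule ccontr)
  assume not1: "\<not> ?thesis"
  have "u \<in> verts G" "v \<in> verts G" "card {u, v} = 2"
    using assms(1,3) unfolding simple_graph_def by blast+
  then have "u \<noteq> v" by auto
  have fin: "finite (f u)" "finite (f v)" and inj: "f u \<noteq> f v"
    using assms(2) \<open>u \<in> verts G\<close> \<open>v \<in> verts G\<close> \<open>u \<noteq> v\<close>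
    by (auto simp: weak_iasi_def iasi_def inj_on_def)
  have "edge_label f {u, v} = f u + f v"
    using \<open>u \<noteq> v\<close> by (simp add: edge_label_def)
  then have sum: "card (f u + f v) = max (card (f u)) (card (f v))"
    using assms(2,3) by (metis weak_iasi_def)
  have "f u \<noteq> {}" "f v \<noteq> {}"
    using sum fin inj by (auto simp: set_plus_def)
  with fin have "card (f u) \<noteq> 0" "card (f v) \<noteq> 0"
    by auto
  with not1 have "1 < card (f u)" "1 < card (f v)"
    by auto
  then have "card (f u) < card (f u + f v)" "card (f v) < card (f u + f v)"
    using card_less_card_sumset[OF fin] card_less_card_sumset[OF fin(2,1)] \<open>f u \<noteq> {}\<close> \<open>f v \<noteq> {}\<close>
    by (auto simp: add.commute)
  with sum show False by linarith
qed

text \<open>One of the two ends of \<open>e\<close> has a label that is not a singleton, for otherwise the label of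
  \<open>e\<close> would have cardinality \<open>max 1 1 = 1\<close>. This end is adjacent to all vertices of the copy.\<close>

lemma copy_one_uniform_if_not_mono_indexed:
  fixes G1 :: "'a ugraph" and G2 :: "'b ugraph" and f :: "'a + 'a set \<times> 'b \<Rightarrow> nat set"
  assumes "simple_graph G1" "simple_graph G2" "weak_iasi (G1 \<diamondop> G2) f"
    and "e \<in> edges G1" "card (edge_label f (Inl ` e)) \<noteq> 1"
  shows "one_uniform (copy_of G2 e) f"
proof -
  have weak: "card (edge_label f {p, q}) = max (card (f p)) (card (f q))"
    if "{p, q} \<in> edges (G1 \<diamondop> G2)" for p q
    using assms(3) that by (auto simp: weak_iasi_def)
  obtain u v where e: "e = {u, v}"
    using assms(1,4) by (metis simple_graph_def card_2_iff)
  have "Inl ` e \<in> edges (G1 \<diamondop> G2)"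
    using assms(4) by (auto simp: edge_corona_def base_of_def image_graph_def)
  then have "\<not> (card (f (Inl u)) = 1 \<and> card (f (Inl v)) = 1)"
    using assms(5) weak[of "Inl u" "Inl v"] by (auto simp: e)
  then obtain w where w: "w \<in> e" "card (f (Inl w)) \<noteq> 1"
    by (auto simp: e)
  have vert: "card (f (Inr (e, x))) = 1" if "x \<in> verts G2" for x
  proof -
    have "{Inl w, Inr (e, x)} \<in> edges (G1 \<diamondop> G2)"
      using assms(4) w(1) that by (auto simp: edge_corona_def)
    from weak_iasi_singleton_end[OF simple_graph_edge_corona[OF assms(1,2)] assms(3) this]
    show ?thesis using w(2) by simp
  qed
  have "card (edge_label f ((\<lambda>x. Inr (e, x)) ` k)) = 1" if k: "k \<in> edges G2" for k
  proof -
    obtain x y where xy: "k = {x, y}" "x \<in> verts G2" "y \<in> verts G2"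
      using assms(2) k by (metis simple_graph_def card_2_iff insert_subset)
    have "(\<lambda>x. Inr (e, x)) ` k \<in> edges (G1 \<diamondop> G2)"
      using assms(4) k by (auto simp: edge_corona_def copy_of_def image_graph_def)
    then show ?thesis
      using weak[of "Inr (e, x)" "Inr (e, y)"] vert xy by auto
  qed
  with vert show ?thesis
    by (auto simp: one_uniform_def copy_of_def image_graph_def)
qed

theorem theorem2p2:
  fixes G1 :: "'a ugraph" and G2 :: "'b ugraph"
    and f :: "'a + 'a set \<times> 'b \<Rightarrow> nat set" and m1 m1' :: nat
  assumes "simple_graph G1" and "simple_graph G2"
    and "m1 = card (edges G1)"
    and "weak_iasi (G1 \<diamondop> G2) f"
    and "m1' = card (mono_indexed_edges (base_of G1 :: ('a + 'a set \<times> 'b) ugraph) f)"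
  shows "one_uniform (base_of G1) f \<or>
    (\<exists>S \<subseteq> edges G1. card S = m1 - m1' \<and> (\<forall>e\<in>S. one_uniform (copy_of G2 e) f))"
proof -
  define M where "M = {e \<in> edges G1. card (edge_label f (Inl ` e)) = 1}"
  have "mono_indexed_edges (base_of G1) f = (`) Inl ` M"
    by (auto simp: M_def mono_indexed_edges_def base_of_def image_graph_def)
  then have "m1' = card M"
    using assms(5) by (simp add: card_image inj_on_def inj_image_eq_iff)
  moreover have "finite (edges G1)"
    by (rule finite_subset[of _ "Pow (verts G1)"]) (use assms(1) in \<open>auto simp: simple_graph_def\<close>)
  then have "card (edges G1 - M) = card (edges G1) - card M"
    by (intro card_Diff_subset) (auto simp: M_def)
  moreover have "one_uniform (copy_of G2 e) f" if "e \<in> edges G1 - M" for e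
    using copy_one_uniform_if_not_mono_indexed[OF assms(1,2,4)] that by (auto simp: M_def)
  ultimately have "\<exists>S \<subseteq> edges G1. card S = m1 - m1' \<and> (\<forall>e\<in>S. one_uniform (copy_of G2 e) f)"
    using assms(3) by (intro exI[of _ "edges G1 - M"]) auto
  then show ?thesis ..
qed

end
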